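(* Let $p\in(0,1)$, and let $(\mathcal{G}_x)_{x\in\mathbb{Z}^2}$ be i.i.d. with $\mathcal{G}_x=\{e_1,e_2\}$ with probability $p$ and $\mathcal{G}_x=\{-e_1,e_2\}$ with probability $1-p$. Then the random walk $(X_n)$ in the associated uniform random environment, started at the origin, satisfies $P(n^{-1}X_n\to v)=1$ with $$v=\Big(\frac{(2p-1)(p^2-p+6)}{6(2-p)(1+p)},\ \frac12\Big).$$
   Context: $e_1=(1,0)$ and $e_2=(0,1)$ are the unit vectors of $\mathbb{Z}^2$. Given a realization of the i.i.d. non-empty sets $(\mathcal{G}_x)_{x\in\mathbb{Z}^2}$, each a subset of $\{\pm e_1,\pm e_2\}$, the walk in the associated uniform random environment is the time-homogeneous Markov chain $(X_n)_{n\ge0}$ on $\mathbb{Z}^2$ with $X_0=0$ that moves from $x$ to $x+e$ with probability $1/|\mathcal{G}_x|$ if $e\in\mathcal{G}_x$, and with probability $0$ otherwise. The environment is sampled once and kept fixed. $P$ denotes the annealed law, i.e. the law of the walk averaged over the environment. *)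

theory Defs
  imports "HOL-Probability.Probability"
begin

type_synonym site = "int \<times> int"

definition e1 :: site where "e1 = (1, 0)"

definition e2 :: site where "e2 = (0, 1)"

definition step_sets :: "site set set" where
  "step_sets = Pow {e1, - e1, e2, - e2} - {{}}"

definition path_space :: "(nat \<Rightarrow> site) measure" where
  "path_space = PiM UNIV (\<lambda>_. count_space UNIV)"

definition step_pmf :: "(site \<Rightarrow> site set) \<Rightarrow> site \<Rightarrow> site pmf" where
  "step_pmf g x = map_pmf (\<lambda>e. x + e) (pmf_of_set (g x))"

(* Conditional law of the n-th position given the positions before time n. *)
definition walk_kernel :: "(site \<Rightarrow> site set) \<Rightarrow> nat \<Rightarrow> (nat \<Rightarrow> site) \<Rightarrow> site measure" where
  "walk_kernel g n \<omega> =
     measure_pmf (case n of 0 \<Rightarrow> return_pmf 0 | Suc m \<Rightarrow> step_pmf g (\<omega> m))"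

interpretation walk: Ionescu_Tulcea "walk_kernel g" "\<lambda>_. count_space UNIV"
  for g :: "site \<Rightarrow> site set"
proof (rule Ionescu_Tulcea.intro)
  fix i :: nat
  show "walk_kernel g i \<in>
      PiM {0..<i} (\<lambda>_. count_space UNIV) \<rightarrow>\<^sub>M subprob_algebra (count_space UNIV)"
  proof (cases i)
    case 0
    then show ?thesis
      unfolding walk_kernel_def by (simp add: measure_pmf_in_subprob_space space_subprob_algebra)
  next
    case (Suc m)
    have "(\<lambda>\<omega>. measure_pmf (step_pmf g (\<omega> m))) \<in>
        PiM {0..<Suc m} (\<lambda>_. count_space UNIV) \<rightarrow>\<^sub>M subprob_algebra (count_space UNIV)"
      by (rule measurable_compose[OF measurable_component_singleton])
         (auto simp: measure_pmf_in_subprob_space)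
    moreover have "walk_kernel g (Suc m) = (\<lambda>\<omega>. measure_pmf (step_pmf g (\<omega> m)))"
      by (simp add: walk_kernel_def fun_eq_iff)
    ultimately show ?thesis by (simp add: Suc)
  qed
qed (simp add: walk_kernel_def prob_space_measure_pmf)

(* The law on path_space of the walk from 0 in the fixed environment g: the Markov chain
   with kernels walk_kernel g given by the Ionescu-Tulcea extension. *)
definition quenched_law :: "(site \<Rightarrow> site set) \<Rightarrow> (nat \<Rightarrow> site) measure" where
  "quenched_law g = walk.PF.lim g"

lemma sets_quenched_law [simp, measurable_cong]: "sets (quenched_law g) = sets path_space"
  by (simp add: quenched_law_def path_space_def)

lemma prob_space_quenched_law: "prob_space (quenched_law g)"
proof
  let ?X = "space (PiM {} (\<lambda>_::nat. count_space (UNIV :: site set)))"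
  have "space (quenched_law g) = prod_emb UNIV (\<lambda>_. count_space UNIV) {} ?X"
    by (auto simp: quenched_law_def prod_emb_def space_PiM)
  then have "emeasure (quenched_law g) (space (quenched_law g)) = emeasure (walk.CI g {}) ?X"
    unfolding quenched_law_def by (simp only: walk.lim finite.emptyI sets.top)
  also have "\<dots> = 1"
    using prob_space.emeasure_space_1[OF walk.PF.prob_space_P[of "{}" g]]
    by (simp add: walk.PF.space_P)
  finally show "emeasure (quenched_law g) (space (quenched_law g)) = 1" .
qed

lemma emeasure_walk_C:
  "emeasure (walk.C g 0 (Suc n) (\<lambda>_. undefined)) {restrict x {0..<Suc n}} =
     ennreal (indicator {0} (x 0) * (\<Prod>i<n. pmf (step_pmf g (x i)) (x (Suc i))))"
proof (induction n)
  case 0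
  have S: "{restrict x {0..<m}} \<in> sets (PiM {0..<m} (\<lambda>_. count_space UNIV))" for m
    by (subst PiE_singleton[symmetric, of "restrict x {0..<m}" "{0..<m}"])
       (auto intro!: sets_PiM_I_finite)
  have "emeasure (walk.eP g 0 (\<lambda>_. undefined)) {restrict x {0..<Suc 0}} =
      emeasure (walk_kernel g 0 (\<lambda>_. undefined))
        ((\<lambda>y. (\<lambda>_. undefined)(0 := y)) -` {restrict x {0..<Suc 0}} \<inter> space (count_space UNIV))"
    using S[of "Suc 0"] by (intro walk.emeasure_eP) (auto simp: space_PiM)
  also have "(\<lambda>y. (\<lambda>_. undefined)(0 := y)) -` {restrict x {0..<Suc 0}} \<inter> space (count_space UNIV)
      = {x 0}"
    by (auto simp: fun_eq_iff restrict_def split: if_splits)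
  also have "emeasure (walk_kernel g 0 (\<lambda>_. undefined)) {x 0} = ennreal (indicator {0} (x 0))"
    by (simp add: walk_kernel_def emeasure_pmf_single pmf_return indicator_def)
  finally have "emeasure (walk.eP g 0 (\<lambda>_. undefined)) {restrict x {0..<Suc 0}} =
      ennreal (indicator {0} (x 0))" .
  moreover have "walk.C g 0 (Suc 0) (\<lambda>_. undefined) = walk.eP g 0 (\<lambda>_. undefined)"
    unfolding walk.C.simps add_0_right
    by (rule bind_return[OF walk.measurable_eP]) (simp add: space_PiM)
  ultimately show ?case
    by (simp only: prod.empty lessThan_0 mult_1_right)
next
  case (Suc n)
  let ?S = "\<lambda>m. {restrict x {0..<m}}"
  let ?C = "walk.C g 0 (Suc n) (\<lambda>_. undefined)"
  have S: "?S m \<in> sets (PiM {0..<m} (\<lambda>_. count_space UNIV))" for m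
    by (subst PiE_singleton[symmetric, of "restrict x {0..<m}" "{0..<m}"])
       (auto intro!: sets_PiM_I_finite)
  have u: "(\<lambda>_. undefined) \<in> space (PiM {0..<0::nat} (\<lambda>_. count_space UNIV))"
    by (simp add: space_PiM)
  have spC: "space ?C = space (PiM {0..<Suc n} (\<lambda>_. count_space UNIV))"
    using walk.space_C[OF u, of g "Suc n"] by simp
  have setC: "sets ?C = sets (PiM {0..<Suc n} (\<lambda>_. count_space UNIV))"
    using walk.sets_C[OF u, of g "Suc n"] by simp
  have eP: "emeasure (walk.eP g (Suc n) \<omega>) (?S (Suc (Suc n))) =
      ennreal (pmf (step_pmf g (x n)) (x (Suc n))) * indicator (?S (Suc n)) \<omega>"
    if w: "\<omega> \<in> space ?C" for \<omega>
  proof -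
    have w': "\<omega> \<in> space (PiM {0..<Suc n} (\<lambda>_. count_space UNIV))"
      using w spC by simp
    have ext: "\<omega> \<in> extensional {0..<Suc n}"
      using w' by (auto simp: space_PiM PiE_def)
    have "emeasure (walk.eP g (Suc n) \<omega>) (?S (Suc (Suc n))) =
        emeasure (walk_kernel g (Suc n) \<omega>)
          ((fun_upd \<omega> (Suc n)) -` {restrict x {0..<Suc (Suc n)}} \<inter> space (count_space UNIV))"
      using w' S by (rule walk.emeasure_eP)
    also have "(fun_upd \<omega> (Suc n)) -` {restrict x {0..<Suc (Suc n)}} \<inter> space (count_space UNIV)
        = (if \<omega> = restrict x {0..<Suc n} then {x (Suc n)} else {})"
    proof -
      have "fun_upd \<omega> (Suc n) y = restrict x {0..<Suc (Suc n)} \<longleftrightarrow>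
          \<omega> = restrict x {0..<Suc n} \<and> y = x (Suc n)" for y
      proof
        assume h: "fun_upd \<omega> (Suc n) y = restrict x {0..<Suc (Suc n)}"
        have "\<omega> i = restrict x {0..<Suc n} i" for i
          using fun_cong[OF h, of i] ext
          by (cases "i < Suc n") (auto simp: extensional_def)
        moreover have "y = x (Suc n)" using fun_cong[OF h, of "Suc n"] by simp
        ultimately show "\<omega> = restrict x {0..<Suc n} \<and> y = x (Suc n)" by blast
      qed (auto simp: fun_eq_iff restrict_def)
      then show ?thesis by auto
    qed
    also have "emeasure (walk_kernel g (Suc n) \<omega>)
        (if \<omega> = restrict x {0..<Suc n} then {x (Suc n)} else {}) =
        ennreal (pmf (step_pmf g (x n)) (x (Suc n))) * indicator (?S (Suc n)) \<omega>"
      by (simp add: walk_kernel_def emeasure_pmf_single indicator_def)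
    finally show ?thesis .
  qed
  have "emeasure (walk.C g 0 (Suc (Suc n)) (\<lambda>_. undefined)) (?S (Suc (Suc n))) =
      emeasure (?C \<bind> walk.eP g (Suc n)) (?S (Suc (Suc n)))"
    by simp
  also have "\<dots> = (\<integral>\<^sup>+\<omega>. emeasure (walk.eP g (Suc n) \<omega>) (?S (Suc (Suc n))) \<partial>?C)"
  proof (rule emeasure_bind)
    show "space ?C \<noteq> {}"
      unfolding spC by (simp add: space_PiM PiE_eq_empty_iff)
    show "walk.eP g (Suc n) \<in> ?C \<rightarrow>\<^sub>M
        subprob_algebra (PiM {0..<Suc (Suc n)} (\<lambda>_. count_space UNIV))"
      using walk.measurable_eP[of g "Suc n"] measurable_cong_sets[OF setC refl] by blast
  qed (rule S)
  also have "\<dots> = (\<integral>\<^sup>+\<omega>. ennreal (pmf (step_pmf g (x n)) (x (Suc n))) * indicator (?S (Suc n)) \<omega> \<partial>?C)"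
    by (rule nn_integral_cong) (rule eP)
  also have "\<dots> = ennreal (pmf (step_pmf g (x n)) (x (Suc n))) * emeasure ?C (?S (Suc n))"
    using S[of "Suc n"] setC by (intro nn_integral_cmult_indicator) simp
  finally show ?case
    by (simp only: Suc.IH)
       (simp add: ennreal_mult[symmetric] prod_nonneg mult_ac)
qed

lemma restrict_eqD: "restrict f A = restrict h A \<Longrightarrow> i \<in> A \<Longrightarrow> f i = h i"
  by (metis restrict_apply')

lemma quenched_law_cylinder:
  "emeasure (quenched_law g) {\<omega>. \<forall>i\<le>n. \<omega> i = x i} =
     ennreal (indicator {0} (x 0) * (\<Prod>i<n. pmf (step_pmf g (x i)) (x (Suc i))))"
proof -
  let ?J = "{0..<Suc n}"
  let ?S = "{restrict x ?J}"
  have S: "?S \<in> sets (PiM ?J (\<lambda>_. count_space UNIV))"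
    by (subst PiE_singleton[symmetric, of "restrict x ?J" ?J])
       (auto intro!: sets_PiM_I_finite)
  have "(\<forall>i\<le>n. \<omega> i = x i) \<longleftrightarrow> restrict \<omega> ?J = restrict x ?J" for \<omega> :: "nat \<Rightarrow> site"
    by (auto simp: less_Suc_eq_le intro!: restrict_ext dest: restrict_eqD)
  then have "{\<omega>. \<forall>i\<le>n. \<omega> i = x i} = prod_emb UNIV (\<lambda>_. count_space UNIV) ?J ?S"
    by (auto simp: prod_emb_def simp del: restrict_apply)
  then have "emeasure (quenched_law g) {\<omega>. \<forall>i\<le>n. \<omega> i = x i} = emeasure (walk.CI g ?J) ?S"
    using walk.lim[of ?J ?S g] S by (simp add: quenched_law_def)
  also have "\<dots> = emeasure (walk.C g 0 (Suc n) (\<lambda>_. undefined))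
      (prod_emb ?J (\<lambda>_. count_space UNIV) ?J ?S)"
    by (rule walk.emeasure_CI) (use S in auto)
  also have "prod_emb ?J (\<lambda>_. count_space UNIV) ?J ?S = ?S"
    using sets.sets_into_space[OF S] by (rule prod_emb_id[unfolded space_PiM[symmetric]])
  finally show ?thesis by (simp only: emeasure_walk_C)
qed

lemma cylinder_in_sets_path_space: "{\<omega>. \<forall>i\<le>n::nat. \<omega> i = x i} \<in> sets path_space"
proof -
  have "{\<omega>. \<forall>i\<le>n. \<omega> i = x i} = prod_emb UNIV (\<lambda>_. count_space UNIV) {..n} (PiE {..n} (\<lambda>i. {x i}))"
    by (auto simp: prod_emb_def PiE_iff)
  then show ?thesis
    unfolding path_space_def by (simp only:) (rule sets_PiM_I, auto)
qed

(* Without this, the monadic composition in annealed_law would be meaningless. *)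
lemma measurable_quenched_law:
  "quenched_law \<in> PiM UNIV (\<lambda>_. count_space step_sets) \<rightarrow>\<^sub>M prob_algebra path_space"
proof (rule measurable_prob_algebra_generated[OF _ Int_stable_prod_algebra prod_algebra_sets_into_space])
  let ?E = "PiM UNIV (\<lambda>_::site. count_space step_sets)"
  show "sets path_space = sigma_sets (\<Pi>\<^sub>E i\<in>UNIV. space (count_space UNIV))
      (prod_algebra (UNIV :: nat set) (\<lambda>_. count_space (UNIV :: site set)))"
    unfolding path_space_def by (rule sets_PiM)
  fix A assume "A \<in> prod_algebra (UNIV :: nat set) (\<lambda>_. count_space (UNIV :: site set))"
  then obtain J B where A: "A = prod_emb UNIV (\<lambda>_. count_space UNIV) J (PiE J B)" and J: "finite J"
    by (elim prod_algebraE) auto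
  obtain n where n: "J \<subseteq> {..n}"
    using J finite_nat_iff_bounded_le by blast
  define L where "L = {xs :: site list. length xs = Suc n \<and> (\<forall>i\<in>J. xs ! i \<in> B i)}"
  let ?cyl = "\<lambda>xs. {\<omega>. \<forall>i\<le>n. \<omega> i = xs ! i}"
  have Aeq: "A = (\<Union>xs\<in>L. ?cyl xs)"
  proof (intro set_eqI iffI)
    fix \<omega> assume "\<omega> \<in> A"
    then have "map \<omega> [0..<Suc n] \<in> L"
      using n by (auto simp: A prod_emb_def PiE_iff L_def simp del: upt_Suc)
    moreover have "\<omega> \<in> ?cyl (map \<omega> [0..<Suc n])" by (simp del: upt_Suc)
    ultimately show "\<omega> \<in> (\<Union>xs\<in>L. ?cyl xs)" by blast
  next
    fix \<omega> assume "\<omega> \<in> (\<Union>xs\<in>L. ?cyl xs)"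
    then show "\<omega> \<in> A"
      using n by (force simp: A prod_emb_def PiE_iff L_def)
  qed
  have disj: "disjoint_family_on ?cyl L"
    by (auto simp: disjoint_family_on_def L_def less_Suc_eq_le intro!: nth_equalityI)
  have ev: "(\<lambda>g. f (g a)) \<in> borel_measurable ?E" for f :: "site set \<Rightarrow> real" and a
    by (rule measurable_compose[OF measurable_component_singleton]) auto
  have "(\<lambda>g. emeasure (quenched_law g) (?cyl xs)) \<in> borel_measurable ?E" for xs
    unfolding quenched_law_cylinder step_pmf_def
    by (intro measurable_compose[OF _ measurable_ennreal] borel_measurable_times
          borel_measurable_prod borel_measurable_const ev)
  note cyl_measurable = this
  have "countable L" by (rule countableI_type)
  have "(\<lambda>p. emeasure (quenched_law (fst p)) (?cyl (snd p))) \<in>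
      borel_measurable (?E \<Otimes>\<^sub>M count_space L)"
  proof (rule measurable_compose_countable'[OF _ measurable_snd \<open>countable L\<close>])
    show "(\<lambda>p. emeasure (quenched_law (fst p)) (?cyl xs)) \<in>
        borel_measurable (?E \<Otimes>\<^sub>M count_space L)" for xs
      using measurable_compose[OF measurable_fst cyl_measurable] .
  qed
  then have "(\<lambda>g. \<integral>\<^sup>+xs. emeasure (quenched_law g) (?cyl xs) \<partial>count_space L) \<in>
      borel_measurable ?E"
    by (rule sigma_finite_measure.borel_measurable_nn_integral
        [OF sigma_finite_measure_count_space_countable[OF \<open>countable L\<close>],
         unfolded case_prod_beta'])
  moreover have "emeasure (quenched_law g) A =
      (\<integral>\<^sup>+xs. emeasure (quenched_law g) (?cyl xs) \<partial>count_space L)" for g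
    unfolding Aeq
    by (rule emeasure_UN_countable[OF _ \<open>countable L\<close> disj])
       (simp add: cylinder_in_sets_path_space)
  ultimately show "(\<lambda>g. emeasure (quenched_law g) A) \<in> borel_measurable ?E"
    by simp
qed (auto simp: prob_space_quenched_law)

(* (M, G) is the random environment; the law of the walk averaged over it. *)
definition annealed_law :: "'a measure \<Rightarrow> (site \<Rightarrow> 'a \<Rightarrow> site set) \<Rightarrow> (nat \<Rightarrow> site) measure" where
  "annealed_law M G = M \<bind> (\<lambda>w. quenched_law (\<lambda>x. G x w))"

definition real_site :: "site \<Rightarrow> real \<times> real" where
  "real_site x = (of_int (fst x), of_int (snd x))"

end

theory Submission
  imports Defs "HOL-Library.Discrete_Functions"
begin

text \<open>Within a row the walk is determined by the revealed sites: it runs over fresh sites until it meets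
  two neighbours pointing at each other, and then bounces between them; a vertical step, always of
  probability 1/2, starts an unseen row. Averaged over the environment, the position is therefore an
  additive functional of a chain with five states. Solving the Poisson equation of this chain turns
  each coordinate, after centring, into a martingale with bounded increments up to a bounded error, so
  its second moment is O(n). Summing along the squares gives convergence there almost surely,
  and bounded steps fill the gaps.\<close>

subsection \<open>The annealed walk as a finite-state chain\<close>

text \<open>RightRun and LeftRun: at a fresh site, reached by horizontal steps away from the entry point of
  the row. AtRight: at a site known to point right whose right neighbour is known to point left;
  AtLeft is that neighbour.\<close>
datatype row_state = Entry | RightRun | LeftRun | AtRight | AtLeft

text \<open>In the states \<open>AtRight\<close> and \<open>AtLeft\<close> the direction of
  \<open>d\<close> is not inspected: the only horizontal step of nonzero \<open>trans_prob\<close>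
  leads to the partner site. A run that turns back lands on the neighbour it came from, which closes
  such a pair.\<close>

definition next_state :: "row_state \<Rightarrow> site \<Rightarrow> row_state" where
  "next_state s d = (if d = e2 then Entry else
     (case s of
        Entry \<Rightarrow> if d = e1 then RightRun else LeftRun
      | RightRun \<Rightarrow> if d = e1 then RightRun else AtRight
      | LeftRun \<Rightarrow> if d = e1 then AtLeft else LeftRun
      | AtRight \<Rightarrow> AtLeft
      | AtLeft \<Rightarrow> AtRight))"

text \<open>Conditional probability, given the revealed sites, that the current site points right.\<close>
definition dir_prob :: "real \<Rightarrow> row_state \<Rightarrow> real" where
  "dir_prob p s = (case s of AtRight \<Rightarrow> 1 | AtLeft \<Rightarrow> 0 | _ \<Rightarrow> p)"

definition trans_prob :: "real \<Rightarrow> row_state \<Rightarrow> site \<Rightarrow> real" where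
  "trans_prob p s d = (if d = e2 then 1 else if d = e1 then dir_prob p s else 1 - dir_prob p s) / 2"

definition steps :: "site set" where
  "steps = {e1, - e1, e2}"

text \<open>Step lists are stored latest step first, so that sum_list is the current position and
  each new step is a Cons.\<close>
definition paths :: "nat \<Rightarrow> site list set" where
  "paths n = {ds. set ds \<subseteq> steps \<and> length ds = n}"

fun state :: "site list \<Rightarrow> row_state" where
  "state [] = Entry"
| "state (d # ds) = next_state (state ds) d"

fun weight :: "real \<Rightarrow> site list \<Rightarrow> real" where
  "weight p [] = 1"
| "weight p (d # ds) = trans_prob p (state ds) d * weight p ds"

fun trace :: "site list \<Rightarrow> (site \<times> site) set" where
  "trace [] = {}"
| "trace (d # ds) = insert (sum_list ds, d) (trace ds)"

text \<open>The invariant tying a state to the history \<open>H\<close> of pairs (site, step taken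
  there). Outside the two bouncing states \<open>x\<close> is unvisited, and in a run the site
  behind it is known to point towards it. In a bouncing state both directions of the pair are known.
  The bound on rows guarantees that an upward step reaches an unseen row.\<close>

definition revealed :: "row_state \<Rightarrow> site \<Rightarrow> (site \<times> site) set \<Rightarrow> bool" where
  "revealed s x H \<longleftrightarrow> (\<forall>(y, d)\<in>H. snd y \<le> snd x) \<and>
     (case s of
        Entry \<Rightarrow> \<forall>(y, d)\<in>H. snd y < snd x
      | RightRun \<Rightarrow> (x - e1, e1) \<in> H \<and> (\<forall>(y, d)\<in>H. snd y = snd x \<longrightarrow> fst y < fst x)
      | LeftRun \<Rightarrow> (x + e1, - e1) \<in> H \<and> (\<forall>(y, d)\<in>H. snd y = snd x \<longrightarrow> fst x < fst y)
      | AtRight \<Rightarrow> (x, e1) \<in> H \<and> (x + e1, - e1) \<in> H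
      | AtLeft \<Rightarrow> (x, - e1) \<in> H \<and> (x - e1, e1) \<in> H)"

lemma steps_distinct [simp]:
  "e1 \<noteq> e2" "e1 \<noteq> - e1" "- e1 \<noteq> e2" "e2 \<noteq> e1" "- e1 \<noteq> e1" "e2 \<noteq> - e1" "e1 \<noteq> 0" "e2 \<noteq> 0"
  by (auto simp: e1_def e2_def zero_prod_def)

lemma fst_snd_e [simp]: "fst e1 = 1" "snd e1 = 0" "fst e2 = 0" "snd e2 = 1"
  by (auto simp: e1_def e2_def)

lemma finite_paths [simp]: "finite (paths n)"
  unfolding paths_def by (rule finite_lists_length_eq) (simp add: steps_def)

lemma paths_0 [simp]: "paths 0 = {[]}"
  by (auto simp: paths_def)

lemma sum_steps: "(\<Sum>d\<in>steps. f d) = f e1 + f (- e1) + f e2" for f :: "site \<Rightarrow> real"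
  by (simp add: steps_def)

lemma sum_paths_Suc: "(\<Sum>ds\<in>paths (Suc n). f ds) = (\<Sum>ds\<in>paths n. \<Sum>d\<in>steps. f (d # ds))"
  for f :: "site list \<Rightarrow> real"
proof -
  have eq: "paths (Suc n) = (\<lambda>(ds, d). d # ds) ` (paths n \<times> steps)"
    by (force simp: paths_def length_Suc_conv image_iff)
  have inj: "inj_on (\<lambda>(ds, d). d # ds) (paths n \<times> steps)"
    by (auto simp: inj_on_def)
  show ?thesis
    unfolding eq sum.reindex[OF inj] sum.cartesian_product by (simp add: case_prod_beta')
qed

lemma sum_trans_prob: "(\<Sum>d\<in>steps. trans_prob p s d) = 1"
  by (simp add: sum_steps trans_prob_def field_simps)

lemma trans_prob_nonneg: "0 < p \<Longrightarrow> p < 1 \<Longrightarrow> 0 \<le> trans_prob p s d"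
  by (auto simp: trans_prob_def dir_prob_def split: row_state.split)

lemma weight_nonneg: "0 < p \<Longrightarrow> p < 1 \<Longrightarrow> 0 \<le> weight p ds"
  by (induction ds) (auto simp: trans_prob_nonneg)

lemma sum_weight: "(\<Sum>ds\<in>paths n. weight p ds) = 1"
  by (induction n) (simp_all add: sum_paths_Suc sum_distrib_right[symmetric] sum_trans_prob)

text \<open>Continuing a run reaches a site beyond all those visited in the row, while turning back
  completes a pair of facing neighbours. The condition on \<open>trans_prob\<close> excludes the
  horizontal step that contradicts a known direction. The order \<open>d + x\<close> matches
  \<open>sum_list\<close> of a Cons.\<close>

lemma revealed_step:
  assumes "revealed s x H" "trans_prob p s d \<noteq> 0" "d \<in> steps"
  shows "revealed (next_state s d) (d + x) (insert (x, d) H)"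
proof -
  consider "d = e2" | "d = e1" | "d = - e1" using assms(3) by (auto simp: steps_def)
  then show ?thesis
  proof cases
    case 1
    then show ?thesis using assms(1)
      by (force simp: revealed_def next_state_def)
  next
    case 2
    then show ?thesis using assms(1,2)
      by (cases s) (force simp: revealed_def next_state_def trans_prob_def dir_prob_def add.commute)+
  next
    case 3
    then show ?thesis using assms(1,2)
      by (cases s) (force simp: revealed_def next_state_def trans_prob_def dir_prob_def)+
  qed
qed

lemma revealed_trace:
  "set ds \<subseteq> steps \<Longrightarrow> weight p ds \<noteq> 0 \<Longrightarrow> revealed (state ds) (sum_list ds) (trace ds)"
proof (induction ds)
  case Nil
  then show ?case by (simp add: revealed_def)
next
  case (Cons d ds)
  then show ?case using revealed_step[of "state ds" "sum_list ds" "trace ds" p d] by simp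
qed

subsection \<open>Second moments via the Poisson equation\<close>

text \<open>The Poisson equation makes \<open>Q\<close> a martingale under the path weights, with
  increments \<open>D\<close>. Orthogonality of the increments lets the second moment of
  \<open>Q\<close> grow by at most \<open>B\<close> per step, and removing the bounded term
  \<open>h\<close> costs only a constant.\<close>

lemma second_moment_bound:
  fixes f :: "site \<Rightarrow> real" and h :: "row_state \<Rightarrow> real"
  assumes p: "0 < p" "p < 1"
    and add: "\<And>x y. f (x + y) = f x + f y"
    and poisson: "\<And>s. (\<Sum>d\<in>steps. trans_prob p s d * (f d + h (next_state s d))) = h s + v"
  shows "\<exists>C\<ge>0. \<forall>n. (\<Sum>ds\<in>paths n. weight p ds * (f (sum_list ds) - real n * v)\<^sup>2) \<le> C * (real n + 1)"
proof -
  define Q where "Q ds = f (sum_list ds) + h (state ds) - real (length ds) * v" for ds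
  define D where "D s d = f d + h (next_state s d) - h s - v" for s d
  define B where "B = Max ((\<lambda>(s, d). (D s d)\<^sup>2) ` (UNIV \<times> steps))"
  define H where "H = Max (range (\<lambda>s. (h s)\<^sup>2))"
  have U: "(UNIV :: row_state set) = {Entry, RightRun, LeftRun, AtRight, AtLeft}"
    using row_state.exhaust by auto
  have fin: "finite (UNIV :: row_state set)" by (simp add: U)
  have B: "(D s d)\<^sup>2 \<le> B" if "d \<in> steps" for s d
    unfolding B_def using that fin by (intro Max_ge) (auto simp: steps_def)
  have H: "(h s)\<^sup>2 \<le> H" for s
    unfolding H_def using fin by (intro Max_ge) auto
  have B0: "0 \<le> B"
    by (rule order_trans[OF zero_le_power2[of "D Entry e2"] B]) (simp add: steps_def)
  have H0: "0 \<le> H" using H[of Entry] zero_le_power2[of "h Entry"] by linarith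
  have f0: "f 0 = 0" using add[of 0 0] by simp
  have D0: "(\<Sum>d\<in>steps. trans_prob p s d * D s d) = 0" for s
  proof -
    have "(\<Sum>d\<in>steps. trans_prob p s d * D s d) =
        (\<Sum>d\<in>steps. trans_prob p s d * (f d + h (next_state s d))) - (\<Sum>d\<in>steps. trans_prob p s d) * (h s + v)"
      unfolding sum_distrib_right sum_subtractf[symmetric]
      by (intro sum.cong) (auto simp: D_def algebra_simps)
    then show ?thesis by (simp add: poisson sum_trans_prob)
  qed
  \<comment> \<open>Expanding the square, the cross term vanishes by \<open>D0\<close>.\<close>
  have step: "(\<Sum>d\<in>steps. trans_prob p s d * (q + D s d)\<^sup>2) \<le> q\<^sup>2 + B" for s q
  proof -
    have "(\<Sum>d\<in>steps. trans_prob p s d * (q + D s d)\<^sup>2) =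
        (\<Sum>d\<in>steps. trans_prob p s d) * q\<^sup>2 + 2 * q * (\<Sum>d\<in>steps. trans_prob p s d * D s d)
        + (\<Sum>d\<in>steps. trans_prob p s d * (D s d)\<^sup>2)"
      unfolding sum_distrib_right sum_distrib_left sum.distrib[symmetric]
      by (intro sum.cong) (auto simp: power2_eq_square algebra_simps)
    also have "\<dots> \<le> q\<^sup>2 + (\<Sum>d\<in>steps. trans_prob p s d * B)"
      by (simp add: D0 sum_trans_prob) (intro sum_mono mult_left_mono B trans_prob_nonneg p)
    finally show ?thesis by (simp add: sum_trans_prob sum_distrib_right[symmetric])
  qed
  have Q2: "(\<Sum>ds\<in>paths n. weight p ds * (Q ds)\<^sup>2) \<le> (h Entry)\<^sup>2 + real n * B" for n
  proof (induction n)
    case 0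
    then show ?case by (simp add: Q_def f0)
  next
    case (Suc n)
    have "Q (d # ds) = Q ds + D (state ds) d" for d ds
      by (simp add: Q_def D_def add algebra_simps)
    then have "(\<Sum>ds\<in>paths (Suc n). weight p ds * (Q ds)\<^sup>2) =
        (\<Sum>ds\<in>paths n. weight p ds * (\<Sum>d\<in>steps. trans_prob p (state ds) d * (Q ds + D (state ds) d)\<^sup>2))"
      by (simp add: sum_paths_Suc sum_distrib_left mult_ac)
    also have "\<dots> \<le> (\<Sum>ds\<in>paths n. weight p ds * ((Q ds)\<^sup>2 + B))"
      by (intro sum_mono mult_left_mono step weight_nonneg p)
    also have "\<dots> = (\<Sum>ds\<in>paths n. weight p ds * (Q ds)\<^sup>2) + (\<Sum>ds\<in>paths n. weight p ds) * B"
      by (simp add: sum.distrib distrib_left sum_distrib_right)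
    finally show ?case using Suc by (simp add: sum_weight algebra_simps)
  qed
  \<comment> \<open>In the constant, \<open>2 * H\<close> comes from the initial value of
    \<open>Q\<close> and another \<open>2 * H\<close> from removing \<open>h\<close>; the factors 2
    come from \<open>(a - b)^2 <= 2 a^2 + 2 b^2\<close>.\<close>
  have "(\<Sum>ds\<in>paths n. weight p ds * (f (sum_list ds) - real n * v)\<^sup>2) \<le> (4 * H + 2 * B) * (real n + 1)" for n
  proof -
    have "(\<Sum>ds\<in>paths n. weight p ds * (f (sum_list ds) - real n * v)\<^sup>2) \<le>
        (\<Sum>ds\<in>paths n. weight p ds * (2 * (Q ds)\<^sup>2 + 2 * H))"
    proof (intro sum_mono mult_left_mono weight_nonneg p)
      fix ds assume "ds \<in> paths n"
      then have "f (sum_list ds) - real n * v = Q ds - h (state ds)"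
        by (simp add: Q_def paths_def)
      moreover have "(Q ds - h (state ds))\<^sup>2 \<le> 2 * (Q ds)\<^sup>2 + 2 * (h (state ds))\<^sup>2"
        using zero_le_power2[of "Q ds + h (state ds)"] by (simp add: power2_eq_square algebra_simps)
      ultimately show "(f (sum_list ds) - real n * v)\<^sup>2 \<le> 2 * (Q ds)\<^sup>2 + 2 * H"
        using H[of "state ds"] by simp
    qed
    also have "\<dots> = 2 * (\<Sum>ds\<in>paths n. weight p ds * (Q ds)\<^sup>2) + (\<Sum>ds\<in>paths n. weight p ds) * (2 * H)"
      by (simp add: sum.distrib distrib_left sum_distrib_right sum_distrib_left mult_ac)
    also have "\<dots> \<le> 2 * (H + real n * B) + 2 * H"
      using Q2[of n] H[of Entry] by (simp add: sum_weight)
    also have "\<dots> \<le> (4 * H + 2 * B) * (real n + 1)"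
      using B0 H0 by (simp add: algebra_simps)
    finally show ?thesis .
  qed
  then show ?thesis using B0 H0 by (intro exI[of _ "4 * H + 2 * B"]) simp
qed

definition drift :: "real \<Rightarrow> real" where
  "drift p = (2 * p - 1) * (p\<^sup>2 - p + 6) / (6 * (2 - p) * (1 + p))"

text \<open>Solves the Poisson equation of the chain with the horizontal step as reward, normalised
  to vanish at Entry; the equation at Entry then determines the drift.\<close>
definition corrector :: "real \<Rightarrow> row_state \<Rightarrow> real" where
  "corrector p s = (let v = drift p in case s of
       Entry \<Rightarrow> 0
     | AtRight \<Rightarrow> 1 / 3 - 2 * v
     | AtLeft \<Rightarrow> - 1 / 3 - 2 * v
     | RightRun \<Rightarrow> (2 * p - 1 + (1 - p) * (1 / 3 - 2 * v) - 2 * v) / (2 - p)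
     | LeftRun \<Rightarrow> (2 * p - 1 + p * (- 1 / 3 - 2 * v) - 2 * v) / (1 + p))"

lemma poisson_horizontal:
  assumes "0 < p" "p < 1"
  shows "(\<Sum>d\<in>steps. trans_prob p s d * (of_int (fst d) + corrector p (next_state s d))) =
    corrector p s + drift p"
proof -
  have nz: "2 - p \<noteq> 0" "1 + p \<noteq> 0" using assms by auto
  let ?v = "drift p"
  let ?r = "corrector p RightRun" and ?l = "corrector p LeftRun"
  have v: "?v * (6 * (2 - p) * (1 + p)) = (2 * p - 1) * (p\<^sup>2 - p + 6)"
    using nz by (simp add: drift_def)
  have r: "?r * (2 - p) = 2 * p - 1 + (1 - p) * (1 / 3 - 2 * ?v) - 2 * ?v"
    using nz by (simp add: corrector_def Let_def)
  have l: "?l * (1 + p) = 2 * p - 1 + p * (- 1 / 3 - 2 * ?v) - 2 * ?v"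
    using nz by (simp add: corrector_def Let_def)
  have bounce: "corrector p Entry = 0" "corrector p AtRight = 1 / 3 - 2 * ?v"
      "corrector p AtLeft = - 1 / 3 - 2 * ?v"
    by (simp_all add: corrector_def Let_def)
  \<comment> \<open>This balance at \<open>Entry\<close> is the equation that fixes the drift.
    Multiplying by both denominators allows \<open>r\<close> and \<open>l\<close> to be substituted
    as polynomial identities.\<close>
  have entry: "p * (1 + ?r) + (1 - p) * (- 1 + ?l) = 2 * ?v"
  proof -
    have "(p * (1 + ?r) + (1 - p) * (- 1 + ?l)) * ((2 - p) * (1 + p)) =
        (2 * p - 1) * ((2 - p) * (1 + p)) + p * (1 + p) * (?r * (2 - p)) + (1 - p) * (2 - p) * (?l * (1 + p))"
      by (simp only: algebra_simps)
    also have "\<dots> = 2 * ?v * ((2 - p) * (1 + p))"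
      unfolding r l using v by (simp add: field_simps power2_eq_square)
    finally show ?thesis using nz by simp
  qed
  \<comment> \<open>The vertical step drops out: it has no horizontal reward and leads to
    \<open>Entry\<close>, where the corrector is zero.\<close>
  have expand: "(\<Sum>d\<in>steps. trans_prob p s d * (of_int (fst d) + corrector p (next_state s d))) =
      dir_prob p s / 2 * (1 + corrector p (next_state s e1))
      + (1 - dir_prob p s) / 2 * (- 1 + corrector p (next_state s (- e1)))"
    by (simp add: sum_steps trans_prob_def next_state_def bounce)
  show ?thesis
  proof (cases s)
    case Entry
    then show ?thesis unfolding expand using entry by (simp add: dir_prob_def next_state_def bounce field_simps)
  next
    case RightRun
    have "p / 2 * (1 + ?r) + (1 - p) / 2 * (- 1 + (1 / 3 - 2 * ?v)) = ?r + ?v"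
      using r by (simp add: field_simps)
    then show ?thesis unfolding expand using RightRun by (simp add: dir_prob_def next_state_def bounce)
  next
    case LeftRun
    have "p / 2 * (1 + (- 1 / 3 - 2 * ?v)) + (1 - p) / 2 * (- 1 + ?l) = ?l + ?v"
      using l by (simp add: field_simps)
    then show ?thesis unfolding expand using LeftRun by (simp add: dir_prob_def next_state_def bounce)
  qed (unfold expand, simp_all add: dir_prob_def next_state_def bounce)
qed

lemma poisson_vertical: "(\<Sum>d\<in>steps. trans_prob p s d * of_int (snd d)) = (1 / 2 :: real)"
  by (simp add: sum_steps trans_prob_def)

subsection \<open>The law of the annealed walk\<close>

locale row_environment = prob_space M for M :: "'a measure" +
  fixes p :: real and G :: "site \<Rightarrow> 'a \<Rightarrow> site set"
  assumes p: "0 < p" "p < 1"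
    and indep: "indep_vars (\<lambda>_. count_space step_sets) G UNIV"
    and prob_right: "\<And>x. prob {w \<in> space M. G x w = {e1, e2}} = p"
    and prob_left: "\<And>x. prob {w \<in> space M. G x w = {- e1, e2}} = 1 - p"
begin

lemma G_measurable: "G x \<in> M \<rightarrow>\<^sub>M count_space step_sets"
  using indep unfolding indep_vars_def by blast

lemma G_in_step_sets: "w \<in> space M \<Longrightarrow> G x w \<in> step_sets"
  using measurable_space[OF G_measurable] by simp

lemma G_event [measurable]: "{w \<in> space M. P (G x w)} \<in> events"
proof -
  have "{w \<in> space M. P (G x w)} = G x -` {S \<in> step_sets. P S} \<inter> space M"
    using G_in_step_sets[of _ x] by auto
  then show ?thesis using measurable_sets[OF G_measurable, of "{S \<in> step_sets. P S}"] by simp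
qed

text \<open>The two events are disjoint and their probabilities add up to 1, so no other set occurs
  outside a null event.\<close>

lemma AE_G: "AE w in M. G x w = {e1, e2} \<or> G x w = {- e1, e2}"
proof -
  let ?R = "{w \<in> space M. G x w = {e1, e2}}" and ?L = "{w \<in> space M. G x w = {- e1, e2}}"
  have "prob (?R \<union> ?L) = prob ?R + prob ?L"
    by (rule finite_measure_Union) (use G_event in \<open>auto simp: doubleton_eq_iff\<close>)
  then have "prob (?R \<union> ?L) = 1" by (simp add: prob_right prob_left)
  then have "AE w in M. w \<in> ?R \<union> ?L"
    by (subst AE_in_set_eq_1) (use G_event in auto)
  then show ?thesis
    by eventually_elim auto
qed

section \<open>Probability that the environment permits a given path\<close>

definition allows :: "site list \<Rightarrow> 'a set" where
  "allows ds = {w \<in> space M. \<forall>(x, d)\<in>trace ds. d \<in> G x w}"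

lemma allows_Nil [simp]: "allows [] = space M"
  by (simp add: allows_def)

lemma allows_Cons: "allows (d # ds) = allows ds \<inter> {w \<in> space M. d \<in> G (sum_list ds) w}"
  by (auto simp: allows_def)

lemma allows_event [measurable]: "allows ds \<in> events"
  by (induction ds) (auto simp: allows_Cons)

lemma finite_trace: "finite (trace ds)"
  by (induction ds) auto

lemma prob_dir:
  assumes "d \<in> steps"
  shows "prob {w \<in> space M. d \<in> G x w} = (if d = e2 then 1 else if d = e1 then p else 1 - p)"
proof -
  \<comment> \<open>By \<open>AE_G\<close>, a predicate of the set at \<open>x\<close> matters only
    through its values on the two possible sets.\<close>
  have eq: "prob {w \<in> space M. P (G x w)} = prob {w \<in> space M. Q (G x w)}"
    if "P {e1, e2} \<longleftrightarrow> Q {e1, e2}" "P {- e1, e2} \<longleftrightarrow> Q {- e1, e2}" for P Q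
    by (rule finite_measure_eq_AE) (use AE_G[of x] that in \<open>auto elim!: eventually_mono\<close>)
  consider "d = e2" | "d = e1" | "d = - e1" using assms by (auto simp: steps_def)
  then show ?thesis
  proof cases
    case 1
    then show ?thesis using eq[of "\<lambda>S. d \<in> S" "\<lambda>_. True"] by (simp add: prob_space)
  next
    case 2
    then show ?thesis using eq[of "\<lambda>S. d \<in> S" "\<lambda>S. S = {e1, e2}"]
      by (simp add: prob_right doubleton_eq_iff)
  next
    case 3
    then show ?thesis using eq[of "\<lambda>S. d \<in> S" "\<lambda>S. S = {- e1, e2}"]
      by (simp add: prob_left doubleton_eq_iff)
  qed
qed

text \<open>The event \<open>allows ds\<close> depends only on the sets at visited sites, so
  independence separates it from an unvisited \<open>x\<close>.\<close>

lemma prob_allows_fresh: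
  assumes fresh: "x \<notin> fst ` trace ds"
  shows "prob (allows ds \<inter> {w \<in> space M. d \<in> G x w}) =
    prob (allows ds) * prob {w \<in> space M. d \<in> G x w}"
\<comment> \<open>The empty history is treated apart because the product rule for independent
  variables is applied to a nonempty index set \<open>J\<close>.\<close>
proof (cases "trace ds = {}")
  case True
  then have "allows ds = space M" by (simp add: allows_def)
  moreover have "space M \<inter> {w \<in> space M. d \<in> G x w} = {w \<in> space M. d \<in> G x w}" by auto
  ultimately show ?thesis by (simp add: prob_space)
next
  case False
  define J where "J = fst ` trace ds"
  \<comment> \<open>A site may be visited several times, so all constraints at \<open>y\<close> are
    merged into one set, giving one factor per site.\<close>
  define A where "A y = (if y = x then {S \<in> step_sets. d \<in> S}
    else {S \<in> step_sets. \<forall>(z, c)\<in>trace ds. z = y \<longrightarrow> c \<in> S})" for y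
  have J: "finite J" "J \<noteq> {}" "x \<notin> J"
    using finite_trace False fresh by (auto simp: J_def)
  have x: "{w \<in> space M. d \<in> G x w} = G x -` A x \<inter> space M"
    using G_in_step_sets[of _ x] by (auto simp: A_def)
  have ds: "allows ds = (\<Inter>y\<in>J. G y -` A y \<inter> space M)"
  proof (rule set_eqI)
    fix w
    have "G y w \<in> A y \<longleftrightarrow> (\<forall>(z, c)\<in>trace ds. z = y \<longrightarrow> c \<in> G y w)"
      if "w \<in> space M" "y \<in> J" for y
    proof -
      have "y \<noteq> x" using that J(3) by blast
      then show ?thesis using G_in_step_sets[OF that(1), of y] by (simp add: A_def)
    qed
    then have "w \<in> (\<Inter>y\<in>J. G y -` A y \<inter> space M) \<longleftrightarrow>
        w \<in> space M \<and> (\<forall>y\<in>J. \<forall>(z, c)\<in>trace ds. z = y \<longrightarrow> c \<in> G y w)"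
      using J(2) by blast
    also have "\<dots> \<longleftrightarrow> w \<in> allows ds"
      unfolding allows_def J_def by force
    finally show "w \<in> allows ds \<longleftrightarrow> w \<in> (\<Inter>y\<in>J. G y -` A y \<inter> space M)" by blast
  qed
  have sub: "A y \<in> sets (count_space step_sets)" for y by (auto simp: A_def)
  have "prob (allows ds \<inter> {w \<in> space M. d \<in> G x w}) =
      prob (\<Inter>y\<in>insert x J. G y -` A y \<inter> space M)"
    unfolding ds x using J by (intro arg_cong[of _ _ prob]) auto
  also have "\<dots> = (\<Prod>y\<in>insert x J. prob (G y -` A y \<inter> space M))"
    by (rule indep_varsD[OF indep]) (use J sub in auto)
  also have "\<dots> = prob (\<Inter>y\<in>J. G y -` A y \<inter> space M) * prob (G x -` A x \<inter> space M)"
    using indep_varsD[OF indep, of J A] J sub by simp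
  finally show ?thesis unfolding ds x .
qed

text \<open>Each factor of \<open>weight\<close> is one half times the conditional probability that
  the step is permitted; the power of 2 undoes these halves. At a fresh site that probability comes
  from independence, in a bouncing state it is 0 or 1 by the history.\<close>

lemma prob_allows:
  "set ds \<subseteq> steps \<Longrightarrow> prob (allows ds) = 2 ^ length ds * weight p ds"
proof (induction ds)
  case Nil
  then show ?case by (simp add: prob_space)
next
  case (Cons d ds)
  let ?x = "sum_list ds" and ?s = "state ds"
  have d: "d \<in> steps" and ds: "set ds \<subseteq> steps" using Cons.prems by auto
  note IH = Cons.IH[OF ds]
  let ?D = "{w \<in> space M. d \<in> G ?x w}"
  have step: "prob (allows ds \<inter> ?D) = prob (allows ds) * (2 * trans_prob p ?s d)"
  \<comment> \<open>With zero weight \<open>allows ds\<close> is null by induction and both sides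
    vanish; only for nonzero weight is the invariant available.\<close>
  proof (cases "weight p ds = 0")
    case True
    have "prob (allows ds \<inter> ?D) \<le> prob (allows ds)"
      by (intro finite_measure_mono) auto
    with True IH show ?thesis by (simp add: antisym)
  next
    case False
    have rev: "revealed ?s ?x (trace ds)" by (rule revealed_trace[OF ds False])
    \<comment> \<open>Covers every step whose permission is almost surely decided by the history,
      with \<open>b\<close> the constant answer.\<close>
    have same: "prob (allows ds \<inter> ?D) = (if b then prob (allows ds) else 0)"
      if "AE w in M. w \<in> allows ds \<longrightarrow> (d \<in> G ?x w \<longleftrightarrow> b)" for b
    proof -
      have "prob (allows ds \<inter> ?D) = prob (allows ds \<inter> (if b then space M else {}))"
        by (rule finite_measure_eq_AE) (use that in \<open>auto elim!: eventually_mono simp: allows_def\<close>)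
      also have "\<dots> = (if b then prob (allows ds) else 0)"
        using sets.sets_into_space[OF allows_event] by (simp add: Int_absorb2)
      finally show ?thesis .
    qed
    have new: ?thesis if "?x \<notin> fst ` trace ds" "dir_prob p ?s = p"
      using prob_allows_fresh[OF that(1)] that(2) d
      by (auto simp: prob_dir trans_prob_def steps_def)
    have fresh: "?x \<notin> fst ` trace ds" if "?s \<noteq> AtRight" "?s \<noteq> AtLeft"
    proof
      assume "?x \<in> fst ` trace ds"
      then obtain c where "(?x, c) \<in> trace ds" by force
      with rev that show False by (cases ?s) (fastforce simp: revealed_def)+
    qed
    have up: ?thesis if "d = e2"
    proof -
      have "AE w in M. w \<in> allows ds \<longrightarrow> (d \<in> G ?x w \<longleftrightarrow> True)"
        using AE_G[of ?x] by eventually_elim (auto simp: that)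
      from same[OF this] that show ?thesis by (simp add: trans_prob_def)
    qed
    have horizontal: "d = e1 \<or> d = - e1" if "d \<noteq> e2" using d that by (auto simp: steps_def)
    show ?thesis
    proof (cases ?s)
      case AtRight
      then have *: "(?x, e1) \<in> trace ds" using rev by (simp add: revealed_def)
      have "AE w in M. w \<in> allows ds \<longrightarrow> (d \<in> G ?x w \<longleftrightarrow> d \<noteq> - e1)"
        using AE_G[of ?x]
      proof eventually_elim
        case (elim w)
        show ?case
        proof
          assume "w \<in> allows ds"
          with * have "e1 \<in> G ?x w" by (auto simp: allows_def)
          with elim horizontal show "d \<in> G ?x w \<longleftrightarrow> d \<noteq> - e1" by (auto split: if_splits)
        qed
      qed
      from same[OF this] AtRight horizontal up show ?thesis
        by (auto simp: trans_prob_def dir_prob_def)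
    next
      case AtLeft
      then have *: "(?x, - e1) \<in> trace ds" using rev by (simp add: revealed_def)
      have "AE w in M. w \<in> allows ds \<longrightarrow> (d \<in> G ?x w \<longleftrightarrow> d \<noteq> e1)"
        using AE_G[of ?x]
      proof eventually_elim
        case (elim w)
        show ?case
        proof
          assume "w \<in> allows ds"
          with * have "- e1 \<in> G ?x w" by (auto simp: allows_def)
          with elim horizontal show "d \<in> G ?x w \<longleftrightarrow> d \<noteq> e1" by (auto split: if_splits)
        qed
      qed
      from same[OF this] AtLeft horizontal up show ?thesis
        by (auto simp: trans_prob_def dir_prob_def)
    qed (use fresh in \<open>simp_all add: new dir_prob_def\<close>)
  qed
  then show ?case by (simp add: allows_Cons IH)
qed

end

section \<open>Cylinder events and their annealed probabilities\<close>

definition cylinder :: "site list \<Rightarrow> (nat \<Rightarrow> site) set" where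
  "cylinder ds = {\<omega>. \<forall>i\<le>length ds. \<omega> i = sum_list (drop (length ds - i) ds)}"

lemma cylinder_sets [measurable]: "cylinder ds \<in> sets path_space"
  unfolding cylinder_def by (rule cylinder_in_sets_path_space)

text \<open>Since \<open>drop (length ds - i) ds\<close> keeps the \<open>i\<close> earliest steps,
  prepending a step changes no earlier position and adds one constraint at the new time.\<close>

lemma cylinder_Cons:
  "\<omega> \<in> cylinder (d # ds) \<longleftrightarrow> \<omega> \<in> cylinder ds \<and> \<omega> (Suc (length ds)) = d + sum_list ds"
  by (auto simp: cylinder_def le_Suc_eq Suc_diff_le)

lemma cylinder_end: "\<omega> \<in> cylinder ds \<Longrightarrow> \<omega> (length ds) = sum_list ds"
  by (auto simp: cylinder_def)

lemma cylinder_unique: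
  "\<omega> \<in> cylinder ds \<Longrightarrow> \<omega> \<in> cylinder cs \<Longrightarrow> length cs = length ds \<Longrightarrow> cs = ds"
proof (induction ds arbitrary: cs)
  case (Cons d ds)
  then obtain c cs' where cs: "cs = c # cs'" by (cases cs) auto
  then have "cs' = ds" using Cons by (auto simp: cylinder_Cons)
  then show ?case using Cons.prems cs by (auto simp: cylinder_Cons)
qed simp

text \<open>Both possible sets have two elements, so each permitted step contributes exactly 1/2 and
  one forbidden step makes the product zero.\<close>

lemma quenched_cylinder:
  assumes g: "\<And>x. g x = {e1, e2} \<or> g x = {- e1, e2}"
  shows "emeasure (quenched_law g) (cylinder ds) =
    ennreal (if \<forall>(x, d)\<in>trace ds. d \<in> g x then (1 / 2) ^ length ds else 0)"
proof -
  have pmf: "pmf (step_pmf g x) (d + x) = (if d \<in> g x then 1 / 2 else 0)" for x d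
  proof -
    have "pmf (step_pmf g x) (x + d) = pmf (pmf_of_set (g x)) d"
      unfolding step_pmf_def by (rule pmf_map_inj') (simp add: inj_on_def)
    moreover have "finite (g x)" "g x \<noteq> {}" "card (g x) = 2" using g[of x] by auto
    ultimately show ?thesis by (auto simp: add.commute indicator_def)
  qed
  have prod: "(\<Prod>i<length ds. pmf (step_pmf g (sum_list (drop (length ds - i) ds)))
      (sum_list (drop (length ds - Suc i) ds))) =
      (if \<forall>(x, d)\<in>trace ds. d \<in> g x then (1 / 2) ^ length ds else 0)"
  proof (induction ds)
    case (Cons d ds)
    \<comment> \<open>For \<open>i < length ds\<close> the dropped prefix always contains the head
      \<open>d\<close>, so all old factors are unchanged.\<close>
    have "(\<Prod>i<length ds. pmf (step_pmf g (sum_list (drop (length (d # ds) - i) (d # ds))))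
        (sum_list (drop (length (d # ds) - Suc i) (d # ds)))) =
        (\<Prod>i<length ds. pmf (step_pmf g (sum_list (drop (length ds - i) ds)))
        (sum_list (drop (length ds - Suc i) ds)))"
      by (intro prod.cong refl) (auto simp: Suc_diff_le drop_Cons' Suc_diff_Suc)
    then show ?case by (simp add: Cons pmf)
  qed simp
  show ?thesis
    unfolding cylinder_def quenched_law_cylinder prod by simp
qed

context row_environment
begin

lemma environment_measurable:
  "(\<lambda>w x. G x w) \<in> M \<rightarrow>\<^sub>M PiM UNIV (\<lambda>_. count_space step_sets)"
  using G_measurable by (rule measurable_PiM_single') (auto simp: G_in_step_sets)

lemma quenched_measurable: "(\<lambda>w. quenched_law (\<lambda>x. G x w)) \<in> M \<rightarrow>\<^sub>M prob_algebra path_space"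
  using measurable_compose[OF environment_measurable measurable_quenched_law] .

lemma sets_annealed [measurable_cong, simp]: "sets (annealed_law M G) = sets path_space"
  unfolding annealed_law_def by (rule sets_bind) (auto simp: not_empty)

lemma prob_space_annealed: "prob_space (annealed_law M G)"
  unfolding annealed_law_def
  by (rule prob_space_bind[OF _ measurable_prob_algebraD[OF quenched_measurable]])
     (simp add: prob_space_quenched_law)

text \<open>Integrating the quenched probability gives \<open>(1/2)^n\<close> times the probability
  of \<open>allows ds\<close>, and the powers of 2 cancel. This is where the walk becomes the
  five-state chain.\<close>

lemma annealed_cylinder:
  assumes "set ds \<subseteq> steps"
  shows "emeasure (annealed_law M G) (cylinder ds) = ennreal (weight p ds)"
proof -
  have "emeasure (annealed_law M G) (cylinder ds) =
      (\<integral>\<^sup>+w. emeasure (quenched_law (\<lambda>x. G x w)) (cylinder ds) \<partial>M)"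
    unfolding annealed_law_def
    by (rule emeasure_bind[OF not_empty measurable_prob_algebraD[OF quenched_measurable]]) simp
  also have "\<dots> = (\<integral>\<^sup>+w. ennreal ((1 / 2) ^ length ds) * indicator (allows ds) w \<partial>M)"
  proof (rule nn_integral_cong_AE)
    \<comment> \<open>The null events of the single sites combine because there are countably many
      sites.\<close>
    have "AE w in M. \<forall>x. G x w = {e1, e2} \<or> G x w = {- e1, e2}"
      using AE_G unfolding AE_all_countable by blast
    then show "AE w in M. emeasure (quenched_law (\<lambda>x. G x w)) (cylinder ds) =
        ennreal ((1 / 2) ^ length ds) * indicator (allows ds) w"
      using AE_space
    proof eventually_elim
      case (elim w)
      then have "emeasure (quenched_law (\<lambda>x. G x w)) (cylinder ds) =
          ennreal (if \<forall>(x, d)\<in>trace ds. d \<in> G x w then (1 / 2) ^ length ds else 0)"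
        by (intro quenched_cylinder) blast
      also have "(\<forall>(x, d)\<in>trace ds. d \<in> G x w) \<longleftrightarrow> w \<in> allows ds"
        using elim(2) by (simp add: allows_def)
      finally show ?case by (simp add: indicator_def)
    qed
  qed
  also have "\<dots> = ennreal ((1 / 2) ^ length ds) * ennreal (prob (allows ds))"
    by (simp add: nn_integral_cmult_indicator emeasure_eq_measure)
  also have "\<dots> = ennreal (weight p ds)"
    using weight_nonneg[OF p, of ds]
    by (simp add: ennreal_mult''[symmetric] prob_allows[OF assms] power_one_over)
  finally show ?thesis .
qed

text \<open>The cylinders of the paths of length \<open>n\<close> are disjoint and their weights
  already sum to 1.\<close>

lemma AE_cylinder: "AE \<omega> in annealed_law M G. \<exists>ds\<in>paths n. \<omega> \<in> cylinder ds"
proof -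
  interpret A: prob_space "annealed_law M G" by (rule prob_space_annealed)
  have "A.prob (\<Union>ds\<in>paths n. cylinder ds) = (\<Sum>ds\<in>paths n. A.prob (cylinder ds))"
  proof (rule A.finite_measure_finite_Union)
    show "disjoint_family_on cylinder (paths n)"
      by (auto simp: disjoint_family_on_def paths_def dest: cylinder_unique)
  qed auto
  also have "\<dots> = (\<Sum>ds\<in>paths n. weight p ds)"
    by (intro sum.cong refl)
       (simp add: measure_def paths_def annealed_cylinder weight_nonneg[OF p])
  finally have "A.prob (\<Union>ds\<in>paths n. cylinder ds) = 1" by (simp add: sum_weight)
  then have "AE \<omega> in annealed_law M G. \<omega> \<in> (\<Union>ds\<in>paths n. cylinder ds)"
    by (subst A.AE_in_set_eq_1) auto
  then show ?thesis by simp
qed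

lemma AE_steps: "AE \<omega> in annealed_law M G. \<forall>n. \<omega> (Suc n) - \<omega> n \<in> steps"
proof (subst AE_all_countable, intro allI)
  fix n
  show "AE \<omega> in annealed_law M G. \<omega> (Suc n) - \<omega> n \<in> steps"
    using AE_cylinder[of "Suc n"]
  proof eventually_elim
    case (elim \<omega>)
    then obtain d ds where "d \<in> steps" "length ds = n" "\<omega> \<in> cylinder (d # ds)"
      by (auto simp: paths_def length_Suc_conv)
    then show ?case by (auto simp: cylinder_Cons dest: cylinder_end)
  qed
qed

text \<open>Almost surely exactly one cylinder contains the walk, and on it the position at time
  \<open>n\<close> is constant. This carries the moment bound for path sums over to the annealed
  law.\<close>

lemma nn_integral_position:
  assumes u: "\<And>x. 0 \<le> u x"
  shows "(\<integral>\<^sup>+\<omega>. ennreal (u (\<omega> n)) \<partial>annealed_law M G) =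
    ennreal (\<Sum>ds\<in>paths n. weight p ds * u (sum_list ds))"
proof -
  have "(\<integral>\<^sup>+\<omega>. ennreal (u (\<omega> n)) \<partial>annealed_law M G) =
      (\<integral>\<^sup>+\<omega>. (\<Sum>ds\<in>paths n. ennreal (u (sum_list ds)) * indicator (cylinder ds) \<omega>) \<partial>annealed_law M G)"
  proof (rule nn_integral_cong_AE)
    show "AE \<omega> in annealed_law M G. ennreal (u (\<omega> n)) =
        (\<Sum>ds\<in>paths n. ennreal (u (sum_list ds)) * indicator (cylinder ds) \<omega>)"
      using AE_cylinder[of n]
    proof eventually_elim
      case (elim \<omega>)
      then obtain ds where ds: "ds \<in> paths n" "\<omega> \<in> cylinder ds" by auto
      then have "\<omega> \<in> cylinder cs \<longleftrightarrow> cs = ds" if "cs \<in> paths n" for cs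
        using that cylinder_unique[of \<omega> ds cs] by (auto simp: paths_def)
      then have "(\<Sum>cs\<in>paths n. ennreal (u (sum_list cs)) * indicator (cylinder cs) \<omega>) =
          (\<Sum>cs\<in>paths n. if cs = ds then ennreal (u (sum_list ds)) else 0)"
        by (intro sum.cong) (auto simp: indicator_def)
      also have "\<dots> = ennreal (u (sum_list ds))" using ds by simp
      finally show ?case using ds cylinder_end[of \<omega> ds] by (simp add: paths_def)
    qed
  qed
  also have "\<dots> = (\<Sum>ds\<in>paths n. ennreal (u (sum_list ds)) * emeasure (annealed_law M G) (cylinder ds))"
    by (subst nn_integral_sum) (auto simp: nn_integral_cmult_indicator)
  also have "\<dots> = (\<Sum>ds\<in>paths n. ennreal (weight p ds * u (sum_list ds)))"
    by (intro sum.cong refl)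
       (simp add: paths_def annealed_cylinder ennreal_mult''[symmetric] u mult.commute weight_nonneg[OF p])
  also have "\<dots> = ennreal (\<Sum>ds\<in>paths n. weight p ds * u (sum_list ds))"
    by (intro sum_ennreal) (simp add: u weight_nonneg[OF p])
  finally show ?thesis .
qed

end

subsection \<open>A strong law from second moments\<close>

text \<open>For \<open>n\<close> between the squares of \<open>k + 1\<close> and
  \<open>k + 2\<close>, the sequence has moved at most \<open>(2 k + 2) K <= 3 (k + 1) K\<close>
  since the last square. Divided by \<open>(k + 1)^2\<close> this is at most
  \<open>3 K / (k + 1)\<close>, the second term of \<open>g\<close>.\<close>

lemma tendsto_zero_of_squares:
  fixes y :: "nat \<Rightarrow> real"
  assumes incr: "\<And>n. \<bar>y (Suc n) - y n\<bar> \<le> K"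
    and sq: "(\<lambda>k. y ((Suc k)\<^sup>2) / real ((Suc k)\<^sup>2)) \<longlonglongrightarrow> 0"
  shows "(\<lambda>n. y n / real n) \<longlonglongrightarrow> 0"
proof -
  define g where "g k = \<bar>y ((Suc k)\<^sup>2) / real ((Suc k)\<^sup>2)\<bar> + 3 * K * inverse (real (Suc k))" for k
  have "0 \<le> K" using incr[of 0] by simp
  have incrs: "\<bar>y (m + j) - y m\<bar> \<le> real j * K" for m j
  proof (induction j)
    case (Suc j)
    have "\<bar>y (m + Suc j) - y m\<bar> \<le> real j * K + K" using incr[of "m + j"] Suc by simp
    then show ?case by (simp add: distrib_right)
  qed simp
  have "(\<lambda>k. \<bar>y ((Suc k)\<^sup>2) / real ((Suc k)\<^sup>2)\<bar> + 3 * K * inverse (real (Suc k))) \<longlonglongrightarrow> \<bar>0\<bar> + 3 * K * 0"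
    by (intro tendsto_intros sq LIMSEQ_inverse_real_of_nat)
  then have g: "g \<longlonglongrightarrow> 0" by (simp add: g_def[abs_def])
  have "filterlim (\<lambda>n. floor_sqrt n - 1) at_top sequentially"
    unfolding filterlim_at_top
  proof
    fix Z :: nat
    show "\<forall>\<^sub>F n in sequentially. Z \<le> floor_sqrt n - 1"
      using eventually_ge_at_top[of "(Suc Z)\<^sup>2"]
    proof eventually_elim
      case (elim n)
      then have "floor_sqrt ((Suc Z)\<^sup>2) \<le> floor_sqrt n" by (rule mono_floor_sqrt')
      then show ?case by simp
    qed
  qed
  from filterlim_compose[OF g this]
  have lim: "(\<lambda>n. g (floor_sqrt n - 1)) \<longlonglongrightarrow> 0" .
  have bound: "\<bar>y n / real n\<bar> \<le> g (floor_sqrt n - 1)" if n: "1 \<le> n" for n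
  proof -
    define k where "k = floor_sqrt n - 1"
    have "0 < floor_sqrt n" using n by simp
    then have Sk: "floor_sqrt n = Suc k" by (simp add: k_def)
    have le: "(Suc k)\<^sup>2 \<le> n" and "n < (Suc (Suc k))\<^sup>2"
      using floor_sqrt_power2_le[of n] Suc_floor_sqrt_power2_gt[of n] Sk by auto
    moreover have "(Suc (Suc k))\<^sup>2 = (Suc k)\<^sup>2 + 2 * k + 3" by (simp add: power2_eq_square)
    moreover have "a \<le> n \<Longrightarrow> n < b \<Longrightarrow> b = a + 2 * k + 3 \<Longrightarrow> n - a \<le> 3 * Suc k" for a b
      by arith
    ultimately have j: "n - (Suc k)\<^sup>2 \<le> 3 * Suc k" using le by blast
    have "\<bar>y n\<bar> \<le> \<bar>y ((Suc k)\<^sup>2)\<bar> + real (n - (Suc k)\<^sup>2) * K"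
      using incrs[of "(Suc k)\<^sup>2" "n - (Suc k)\<^sup>2"] le by simp
    also have "real (n - (Suc k)\<^sup>2) * K \<le> real (3 * Suc k) * K"
      using j \<open>0 \<le> K\<close> by (intro mult_right_mono) (simp_all only: of_nat_le_iff)
    finally have "\<bar>y n\<bar> / real n \<le> (\<bar>y ((Suc k)\<^sup>2)\<bar> + real (3 * Suc k) * K) / real n"
      by (intro divide_right_mono) auto
    also have "\<dots> \<le> (\<bar>y ((Suc k)\<^sup>2)\<bar> + real (3 * Suc k) * K) / real ((Suc k)\<^sup>2)"
      using le n \<open>0 \<le> K\<close> by (intro divide_left_mono mult_pos_pos add_nonneg_nonneg) (auto simp del: of_nat_power)
    also have "\<dots> = g k"
    proof -
      have "(a + 3 * t * K) / t\<^sup>2 = a / t\<^sup>2 + 3 * K * inverse t" if "0 < t" for a t :: real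
        using that by (simp add: field_simps power2_eq_square)
      from this[of "real (Suc k)"]
      have "(a + 3 * real (Suc k) * K) / (real (Suc k))\<^sup>2 =
          a / (real (Suc k))\<^sup>2 + 3 * K * inverse (real (Suc k))" for a
        by simp
      then show ?thesis
        by (simp only: g_def abs_divide abs_of_nat of_nat_mult of_nat_numeral of_nat_power abs_power2)
    qed
    finally show ?thesis by (simp add: k_def)
  qed
  show ?thesis
    by (rule Lim_null_comparison[OF _ lim])
       (use bound in \<open>auto intro: eventually_mono[OF eventually_ge_at_top[of 1]]\<close>)
qed

text \<open>Along the squares the second moments of \<open>Y n / n\<close> are at most
  \<open>2 C / (k + 1)^2\<close>. Their sum is finite, so the series of squared values converges
  almost surely and its terms tend to 0.\<close>

lemma (in prob_space) AE_tendsto_zero_of_second_moment: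
  fixes Y :: "nat \<Rightarrow> 'a \<Rightarrow> real"
  assumes Y [measurable]: "\<And>n. Y n \<in> borel_measurable M"
    and incr: "AE w in M. \<forall>n. \<bar>Y (Suc n) w - Y n w\<bar> \<le> K"
    and C: "0 \<le> C" and moment: "\<And>n. (\<integral>\<^sup>+w. ennreal ((Y n w)\<^sup>2) \<partial>M) \<le> ennreal (C * (real n + 1))"
  shows "AE w in M. (\<lambda>n. Y n w / real n) \<longlonglongrightarrow> 0"
proof -
  define S where "S k = (Suc k)\<^sup>2" for k :: nat
  have summ: "summable (\<lambda>k. 2 * C * inverse (real (Suc k) ^ 2))"
    using inverse_power_summable[of 2, where 'a = real] summable_Suc_iff[of "\<lambda>k. inverse (real k ^ 2)"]
    by (intro summable_mult) simp
  have bd: "(\<integral>\<^sup>+w. ennreal ((Y (S k) w / real (S k))\<^sup>2) \<partial>M) \<le> ennreal (2 * C * inverse (real (Suc k) ^ 2))" for k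
  proof -
    have S1: "1 \<le> real (S k)" by (simp add: S_def)
    have "(\<integral>\<^sup>+w. ennreal ((Y (S k) w / real (S k))\<^sup>2) \<partial>M) =
        (\<integral>\<^sup>+w. ennreal (inverse ((real (S k))\<^sup>2)) * ennreal ((Y (S k) w)\<^sup>2) \<partial>M)"
      by (intro nn_integral_cong) (simp add: ennreal_mult''[symmetric] divide_inverse_commute power_mult_distrib power_inverse)
    also have "\<dots> = ennreal (inverse ((real (S k))\<^sup>2)) * (\<integral>\<^sup>+w. ennreal ((Y (S k) w)\<^sup>2) \<partial>M)"
      by (rule nn_integral_cmult) simp
    also have "\<dots> \<le> ennreal (inverse ((real (S k))\<^sup>2)) * ennreal (C * (real (S k) + 1))"
      by (intro mult_left_mono moment) simp
    also have "\<dots> = ennreal (inverse ((real (S k))\<^sup>2) * (C * (real (S k) + 1)))"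
      using C by (simp add: ennreal_mult''[symmetric])
    \<comment> \<open>Uses \<open>S k + 1 <= 2 * S k\<close>, so that one factor \<open>S k\<close>
      cancels.\<close>
    also have "\<dots> \<le> ennreal (inverse ((real (S k))\<^sup>2) * (C * (2 * real (S k))))"
      using S1 C by (intro ennreal_leI mult_left_mono) auto
    also have "inverse ((real (S k))\<^sup>2) * (C * (2 * real (S k))) = 2 * C * inverse (real (S k))"
      using S1 by (simp add: power2_eq_square field_simps)
    finally show ?thesis by (simp add: S_def)
  qed
  have "(\<integral>\<^sup>+w. (\<Sum>k. ennreal ((Y (S k) w / real (S k))\<^sup>2)) \<partial>M) =
      (\<Sum>k. \<integral>\<^sup>+w. ennreal ((Y (S k) w / real (S k))\<^sup>2) \<partial>M)"
    by (rule nn_integral_suminf) simp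
  also have "\<dots> \<le> (\<Sum>k. ennreal (2 * C * inverse (real (Suc k) ^ 2)))"
    by (intro suminf_le bd) auto
  also have "\<dots> < top"
    using C summ by (subst suminf_ennreal2) (auto simp: less_top[symmetric])
  finally have "AE w in M. (\<Sum>k. ennreal ((Y (S k) w / real (S k))\<^sup>2)) \<noteq> \<infinity>"
    by (intro nn_integral_PInf_AE) auto
  with incr show ?thesis
  proof eventually_elim
    case (elim w)
    then have "summable (\<lambda>k. (Y (S k) w / real (S k))\<^sup>2)"
      by (intro summable_suminf_not_top) auto
    then have "(\<lambda>k. (Y (S k) w / real (S k))\<^sup>2) \<longlonglongrightarrow> 0" by (rule summable_LIMSEQ_zero)
    then have "(\<lambda>k. Y (S k) w / real (S k)) \<longlonglongrightarrow> 0" by simp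
    then show ?case
      using elim(1) by (intro tendsto_zero_of_squares[of "\<lambda>n. Y n w" K]) (auto simp: S_def)
  qed
qed

section \<open>Almost sure speed of each coordinate\<close>

lemma (in row_environment) AE_speed:
  fixes f :: "site \<Rightarrow> real"
  assumes add: "\<And>x y. f (x + y) = f x + f y"
    and poisson: "\<And>s. (\<Sum>d\<in>steps. trans_prob p s d * (f d + h (next_state s d))) = h s + v"
  shows "AE \<omega> in annealed_law M G. (\<lambda>n. f (\<omega> n) / real n) \<longlonglongrightarrow> v"
proof -
  interpret A: prob_space "annealed_law M G" by (rule prob_space_annealed)
  obtain C where C: "0 \<le> C"
    "\<And>n. (\<Sum>ds\<in>paths n. weight p ds * (f (sum_list ds) - real n * v)\<^sup>2) \<le> C * (real n + 1)"
    using second_moment_bound[OF p add poisson] by auto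
  have diff: "f (x - y) = f x - f y" for x y using add[of "x - y" y] by simp
  \<comment> \<open>A common bound for the centred increments over the three possible steps.\<close>
  define K where "K = (\<Sum>d\<in>steps. \<bar>f d\<bar>) + \<bar>v\<bar>"
  have K: "\<bar>f d - v\<bar> \<le> K" if "d \<in> steps" for d
  proof -
    have "\<bar>f d\<bar> \<le> (\<Sum>d\<in>steps. \<bar>f d\<bar>)"
      by (rule member_le_sum) (use that in \<open>auto simp: steps_def\<close>)
    then show ?thesis by (simp add: K_def)
  qed
  have "AE \<omega> in annealed_law M G. (\<lambda>n. (f (\<omega> n) - real n * v) / real n) \<longlonglongrightarrow> 0"
  proof (rule A.AE_tendsto_zero_of_second_moment[OF _ _ C(1), where K = K])
    show "(\<lambda>\<omega>. f (\<omega> n) - real n * v) \<in> borel_measurable (annealed_law M G)" for n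
    proof -
      have "(\<lambda>\<omega>. f (\<omega> n)) \<in> borel_measurable path_space"
        unfolding path_space_def
        by (rule measurable_compose[OF measurable_component_singleton]) auto
      then show ?thesis by simp
    qed
    show "AE \<omega> in annealed_law M G.
        \<forall>n. \<bar>(f (\<omega> (Suc n)) - real (Suc n) * v) - (f (\<omega> n) - real n * v)\<bar> \<le> K"
      using AE_steps
    proof eventually_elim
      case (elim \<omega>)
      then have "\<bar>f (\<omega> (Suc n) - \<omega> n) - v\<bar> \<le> K" for n by (simp add: K)
      then show ?case by (simp add: diff algebra_simps)
    qed
    show "(\<integral>\<^sup>+\<omega>. ennreal ((f (\<omega> n) - real n * v)\<^sup>2) \<partial>annealed_law M G) \<le> ennreal (C * (real n + 1))" for n
      by (subst nn_integral_position) (auto intro: ennreal_leI C(2))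
  qed
  then show ?thesis
  proof eventually_elim
    case (elim \<omega>)
    then have "(\<lambda>n. (f (\<omega> n) - real n * v) / real n + v) \<longlonglongrightarrow> 0 + v"
      by (intro tendsto_intros)
    then have "(\<lambda>n. (f (\<omega> n) - real n * v) / real n + v) \<longlonglongrightarrow> v" by simp
    then show ?case
      \<comment> \<open>The two sequences need only agree for positive \<open>n\<close>; at 0 the
        division returns the default value 0.\<close>
      by (rule Lim_transform_eventually[OF _ eventually_mono[OF eventually_gt_at_top[of 0]]])
         (auto simp: field_simps)
  qed
qed

theorem mainTheorem3:
  fixes p :: real and M :: "'a measure" and G :: "site \<Rightarrow> 'a \<Rightarrow> site set"
  assumes "0 < p" and "p < 1"
    and "prob_space M"
    and "prob_space.indep_vars M (\<lambda>_. count_space step_sets) G UNIV"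
    and "\<And>x. measure M {w \<in> space M. G x w = {e1, e2}} = p"
    and "\<And>x. measure M {w \<in> space M. G x w = {- e1, e2}} = 1 - p"
  shows "measure (annealed_law M G)
      {X \<in> space (annealed_law M G).
        (\<lambda>n. (1 / real n) *\<^sub>R real_site (X n)) \<longlonglongrightarrow>
          ((2 * p - 1) * (p\<^sup>2 - p + 6) / (6 * (2 - p) * (1 + p)), 1 / 2)} = 1"
proof -
  interpret row_environment M p G
    using assms by (intro row_environment.intro row_environment_axioms.intro) auto
  interpret A: prob_space "annealed_law M G" by (rule prob_space_annealed)
  let ?Z = "\<lambda>n X. (1 / real n) *\<^sub>R real_site (X n)"
  have Z: "?Z n \<in> borel_measurable (annealed_law M G)" for n
  proof -
    have "?Z n \<in> borel_measurable path_space"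
      unfolding path_space_def
      by (rule measurable_compose[OF measurable_component_singleton]) auto
    then show ?thesis by simp
  qed
  have horizontal: "AE X in annealed_law M G. (\<lambda>n. of_int (fst (X n)) / real n) \<longlonglongrightarrow> drift p"
    by (rule AE_speed[OF _ poisson_horizontal[OF p]]) simp
  \<comment> \<open>A vertical step has probability 1/2 in every state, so the zero function already
    solves the Poisson equation.\<close>
  have vertical: "AE X in annealed_law M G. (\<lambda>n. of_int (snd (X n)) / real n) \<longlonglongrightarrow> 1 / 2"
    by (rule AE_speed[where h = "\<lambda>_. 0"]) (simp_all add: poisson_vertical)
  have "AE X in annealed_law M G. (\<lambda>n. ?Z n X) \<longlonglongrightarrow> (drift p, 1 / 2)"
    using horizontal vertical
  proof eventually_elim
    case (elim X)
    then show ?case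
      using tendsto_Pair[OF elim] by (simp add: real_site_def)
  qed
  \<comment> \<open>Measurability of the convergence event turns the almost sure statement into one
    about its measure.\<close>
  moreover have "{X \<in> space (annealed_law M G). (\<lambda>n. ?Z n X) \<longlonglongrightarrow> (drift p, 1 / 2)} \<in> A.events"
    by (rule predE, rule measurable_limit) (rule Z)
  ultimately show ?thesis
    unfolding drift_def[symmetric] by (subst A.prob_Collect_eq_1) auto
qed

end
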